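(* Let $p$ be a prime. 1. The map $\Psi_p\colon\mathcal{R}\otimes_{\mathbb{Z}}\mathbb{F}_p\to\mathcal{R}\otimes_{\mathbb{Z}}\mathbb{F}_p$ defined by $\Psi_p\left(\binom{x}{k}\right)=\binom{x}{pk}$ for $k\in\mathbb{N}$ and extended $\mathbb{F}_p$-linearly is a ring homomorphism. 2. $\Psi_p$ admits a one-sided inverse $\widetilde{\Psi}_p\colon\mathcal{R}\otimes_{\mathbb{Z}}\mathbb{F}_p\to\mathcal{R}\otimes_{\mathbb{Z}}\mathbb{F}_p$ (i.e. $\widetilde{\Psi}_p\circ\Psi_p=\mathrm{id}$), defined $\mathbb{F}_p$-linearly by $\widetilde{\Psi}_p\left(\binom{x}{k}\right)=\binom{x}{k/p}$ if $p\mid k$ and $\widetilde{\Psi}_p\left(\binom{x}{k}\right)=0$ otherwise.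
   Context: $\mathbb{N}=\{0,1,2,\dots\}$. $\mathcal{R}:=\{P(x)\in\mathbb{Q}[x] : P(n)\in\mathbb{Z}\text{ for all }n\in\mathbb{N}\}$ is the ring of integer-valued polynomials; it is a free $\mathbb{Z}$-module with basis $\binom{x}{k}:=\frac{x(x-1)\cdots(x-k+1)}{k!}$ for $k\ge1$ and $\binom{x}{0}:=1$. The image of $\binom{x}{k}$ in $\mathcal{R}\otimes_{\mathbb{Z}}\mathbb{F}_p$ is denoted by the same symbol; these images form an $\mathbb{F}_p$-basis. *)

theory Defs
  imports
    "HOL-Computational_Algebra.Polynomial"
    "HOL-Library.FuncSet"
    "HOL-Algebra.Free_Abelian_Groups"
    "HOL-Algebra.QuotRing"
    "HOL-Algebra.Module"
    "HOL-Number_Theory.Residues"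
begin

section \<open>Tensor products of commutative rings over the integers\<close>

text \<open>The monoid ring \<open>\<int>[M]\<close>: finite formal \<open>\<int>\<close>-linear combinations of elements of \<open>M\<close>, with the
  bilinear extension of the product of \<open>M\<close>. (The type class multiplication of \<open>\<Rightarrow>\<^sub>0\<close> is not
  applicable here, as it is the convolution with respect to addition of the keys.)\<close>

definition monoid_ring_mult :: "('a, 'm) monoid_scheme \<Rightarrow> ('a \<Rightarrow>\<^sub>0 int) \<Rightarrow> ('a \<Rightarrow>\<^sub>0 int) \<Rightarrow> ('a \<Rightarrow>\<^sub>0 int)"
  where "monoid_ring_mult M f g = frag_extend (\<lambda>x. frag_extend (\<lambda>y. frag_of (x \<otimes>\<^bsub>M\<^esub> y)) g) f"

definition integral_monoid_ring :: "('a, 'm) monoid_scheme \<Rightarrow> ('a \<Rightarrow>\<^sub>0 int) ring"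
  where "integral_monoid_ring M =
    \<lparr>carrier = {f. Poly_Mapping.keys f \<subseteq> carrier M},
     monoid.mult = monoid_ring_mult M,
     one = frag_of \<one>\<^bsub>M\<^esub>,
     zero = 0,
     add = (+)\<rparr>"

text \<open>As an additive group, \<open>\<int>[A \<times> B]\<close> is the free abelian group on \<open>carrier A \<times> carrier B\<close>. The relations
  below are stable under multiplication by pairs, so the ideal they generate is the subgroup they
  generate, and the quotient is the usual tensor product with
  \<open>(a \<otimes> b)(a' \<otimes> b') = aa' \<otimes> bb'\<close>.\<close>

definition tensor_relations :: "('a, 'm) ring_scheme \<Rightarrow> ('b, 'n) ring_scheme \<Rightarrow> (('a \<times> 'b) \<Rightarrow>\<^sub>0 int) set"
  where "tensor_relations A B =
    {frag_of (a \<oplus>\<^bsub>A\<^esub> a', b) - frag_of (a, b) - frag_of (a', b) | a a' b.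
       a \<in> carrier A \<and> a' \<in> carrier A \<and> b \<in> carrier B} \<union>
    {frag_of (a, b \<oplus>\<^bsub>B\<^esub> b') - frag_of (a, b) - frag_of (a, b') | a b b'.
       a \<in> carrier A \<and> b \<in> carrier B \<and> b' \<in> carrier B}"

definition tensor_ideal :: "('a, 'm) ring_scheme \<Rightarrow> ('b, 'n) ring_scheme \<Rightarrow> (('a \<times> 'b) \<Rightarrow>\<^sub>0 int) set"
  where "tensor_ideal A B = genideal (integral_monoid_ring (A \<times>\<times> B)) (tensor_relations A B)"

definition tensor_ring :: "('a, 'm) ring_scheme \<Rightarrow> ('b, 'n) ring_scheme \<Rightarrow> (('a \<times> 'b) \<Rightarrow>\<^sub>0 int) set ring"
  where "tensor_ring A B = integral_monoid_ring (A \<times>\<times> B) Quot tensor_ideal A B"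

definition pure_tensor ::
    "('a, 'm) ring_scheme \<Rightarrow> ('b, 'n) ring_scheme \<Rightarrow> 'a \<Rightarrow> 'b \<Rightarrow> (('a \<times> 'b) \<Rightarrow>\<^sub>0 int) set"
  where "pure_tensor A B a b = tensor_ideal A B +>\<^bsub>integral_monoid_ring (A \<times>\<times> B)\<^esub> frag_of (a, b)"

text \<open>\<open>A \<otimes>\<^sub>\<int> B\<close> with its \<open>B\<close>-algebra structure \<open>c \<cdot> t = (1 \<otimes> c) t\<close>.\<close>

definition base_change ::
    "('a, 'm) ring_scheme \<Rightarrow> ('b, 'n) ring_scheme \<Rightarrow> ('b, (('a \<times> 'b) \<Rightarrow>\<^sub>0 int) set) module"
  where "base_change A B =
    \<lparr>carrier = carrier (tensor_ring A B),
     monoid.mult = monoid.mult (tensor_ring A B),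
     one = one (tensor_ring A B),
     zero = zero (tensor_ring A B),
     add = add (tensor_ring A B),
     smult = (\<lambda>c t. pure_tensor A B \<one>\<^bsub>A\<^esub> c \<otimes>\<^bsub>tensor_ring A B\<^esub> t)\<rparr>"

lemma monoid_ring_mult_frag_of [simp]:
  "monoid_ring_mult M (frag_of x) (frag_of y) = frag_of (x \<otimes>\<^bsub>M\<^esub> y)"
  by (simp add: monoid_ring_mult_def)

lemma monoid_ring_mult_0_left [simp]: "monoid_ring_mult M 0 g = 0"
  by (simp add: monoid_ring_mult_def)

lemma monoid_ring_mult_0_right [simp]: "monoid_ring_mult M f 0 = 0"
  by (simp add: monoid_ring_mult_def frag_extend_eq_0)

lemma monoid_ring_mult_diff_left:
  "monoid_ring_mult M (f - f') g = monoid_ring_mult M f g - monoid_ring_mult M f' g"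
  by (simp add: monoid_ring_mult_def frag_extend_diff)

lemma frag_cmul_diff_right: "frag_cmul c (a - b) = frag_cmul c a - frag_cmul c b"
  by (rule poly_mapping_eqI) (simp add: lookup_minus right_diff_distrib)

lemma monoid_ring_mult_diff_right:
  "monoid_ring_mult M f (g - g') = monoid_ring_mult M f g - monoid_ring_mult M f g'"
  unfolding monoid_ring_mult_def frag_extend_diff
  by (simp add: frag_extend_def [where x = f] frag_cmul_diff_right sum_subtractf)

lemma monoid_ring_mult_add_left:
  "monoid_ring_mult M (f + f') g = monoid_ring_mult M f g + monoid_ring_mult M f' g"
  by (simp add: monoid_ring_mult_def frag_extend_add)

lemma monoid_ring_mult_closed:
  assumes "Group.monoid M" "Poly_Mapping.keys f \<subseteq> carrier M" "Poly_Mapping.keys g \<subseteq> carrier M"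
  shows "Poly_Mapping.keys (monoid_ring_mult M f g) \<subseteq> carrier M"
proof -
  interpret Group.monoid M by fact
  have "Poly_Mapping.keys (frag_extend (\<lambda>y. frag_of (x \<otimes>\<^bsub>M\<^esub> y)) g) \<subseteq> carrier M"
    if "x \<in> Poly_Mapping.keys f" for x
    using keys_frag_extend [of "\<lambda>y. frag_of (x \<otimes>\<^bsub>M\<^esub> y)" g] assms that by fastforce
  then show ?thesis
    unfolding monoid_ring_mult_def
    using keys_frag_extend [of "\<lambda>x. frag_extend (\<lambda>y. frag_of (x \<otimes>\<^bsub>M\<^esub> y)) g" f] by blast
qed

lemma cring_integral_monoid_ring:
  assumes "Group.comm_monoid M"
  shows "cring (integral_monoid_ring M)"
proof (rule cringI)
  interpret Group.comm_monoid M by fact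
  have mon: "Group.monoid M" by unfold_locales
  let ?K = "\<lambda>f. Poly_Mapping.keys f \<subseteq> carrier M"
  let ?m = "monoid_ring_mult M"
  note diff = monoid_ring_mult_diff_left monoid_ring_mult_diff_right
  show "abelian_group (integral_monoid_ring M)"
  proof (rule abelian_groupI)
    fix x assume "x \<in> carrier (integral_monoid_ring M)"
    then show "\<exists>y\<in>carrier (integral_monoid_ring M).
        y \<oplus>\<^bsub>integral_monoid_ring M\<^esub> x = \<zero>\<^bsub>integral_monoid_ring M\<^esub>"
      by (intro bexI [of _ "- x"]) (auto simp: integral_monoid_ring_def)
  qed (use keys_add in \<open>fastforce simp: integral_monoid_ring_def\<close>)+
  have assoc: "?m (?m f g) h = ?m f (?m g h)" if "?K f" "?K g" "?K h" for f g h
    using that(1)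
  proof (induction f rule: frag_induction)
    case (one x)
    show ?case using that(2)
    proof (induction g rule: frag_induction)
      case (one y)
      show ?case using that(3)
        by (induction h rule: frag_induction)
           (use \<open>x \<in> _\<close> one in \<open>simp_all add: diff m_assoc\<close>)
    qed (simp_all add: diff)
  qed (simp_all add: diff)
  have comm: "?m f g = ?m g f" if "?K f" "?K g" for f g
    using that(1)
  proof (induction f rule: frag_induction)
    case (one x)
    show ?case using that(2)
      by (induction g rule: frag_induction) (use one in \<open>simp_all add: diff m_comm\<close>)
  qed (simp_all add: diff)
  have one: "?m (frag_of \<one>\<^bsub>M\<^esub>) f = f" if "?K f" for f
    using that by (induction f rule: frag_induction) (simp_all add: diff)
  show "Group.comm_monoid (integral_monoid_ring M)"
    by (rule comm_monoidI)
       (auto simp: integral_monoid_ring_def assoc one intro: comm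
             dest: subsetD [OF monoid_ring_mult_closed [OF mon]])
qed (simp add: integral_monoid_ring_def monoid_ring_mult_add_left)

lemma
  assumes "cring A" "cring B"
  shows ideal_tensor_ideal: "ideal (tensor_ideal A B) (integral_monoid_ring (A \<times>\<times> B))"
    and tensor_relations_subset: "tensor_relations A B \<subseteq> tensor_ideal A B"
    and cring_tensor_ring: "cring (tensor_ring A B)"
proof -
  interpret A: cring A by fact
  interpret B: cring B by fact
  have "Group.comm_monoid (A \<times>\<times> B)"
    by (intro comm_monoidI) (auto simp: DirProd_def A.m_assoc B.m_assoc intro: A.m_comm B.m_comm)
  then interpret F: cring "integral_monoid_ring (A \<times>\<times> B)"
    by (rule cring_integral_monoid_ring)
  have sub: "tensor_relations A B \<subseteq> carrier (integral_monoid_ring (A \<times>\<times> B))"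
    unfolding tensor_relations_def integral_monoid_ring_def
    by (auto simp: DirProd_def dest!: subsetD [OF keys_diff])
  show 1: "ideal (tensor_ideal A B) (integral_monoid_ring (A \<times>\<times> B))"
    unfolding tensor_ideal_def by (rule F.genideal_ideal [OF sub])
  show "tensor_relations A B \<subseteq> tensor_ideal A B"
    unfolding tensor_ideal_def by (rule F.genideal_self [OF sub])
  show "cring (tensor_ring A B)"
    unfolding tensor_ring_def by (rule ideal.quotient_is_cring [OF 1 F.cring_axioms])
qed

lemma
  assumes "cring A" "cring B"
  shows pure_tensor_closed: "\<lbrakk>a \<in> carrier A; b \<in> carrier B\<rbrakk> \<Longrightarrow> pure_tensor A B a b \<in> carrier (tensor_ring A B)"
    and pure_tensor_mult: "\<lbrakk>a \<in> carrier A; b \<in> carrier B; a' \<in> carrier A; b' \<in> carrier B\<rbrakk> \<Longrightarrow>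
      pure_tensor A B a b \<otimes>\<^bsub>tensor_ring A B\<^esub> pure_tensor A B a' b' =
      pure_tensor A B (a \<otimes>\<^bsub>A\<^esub> a') (b \<otimes>\<^bsub>B\<^esub> b')"
    and pure_tensor_one: "pure_tensor A B \<one>\<^bsub>A\<^esub> \<one>\<^bsub>B\<^esub> = \<one>\<^bsub>tensor_ring A B\<^esub>"
    and pure_tensor_add_left: "\<lbrakk>a \<in> carrier A; a' \<in> carrier A; b \<in> carrier B\<rbrakk> \<Longrightarrow>
      pure_tensor A B (a \<oplus>\<^bsub>A\<^esub> a') b = pure_tensor A B a b \<oplus>\<^bsub>tensor_ring A B\<^esub> pure_tensor A B a' b"
    and pure_tensor_add_right: "\<lbrakk>a \<in> carrier A; b \<in> carrier B; b' \<in> carrier B\<rbrakk> \<Longrightarrow>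
      pure_tensor A B a (b \<oplus>\<^bsub>B\<^esub> b') = pure_tensor A B a b \<oplus>\<^bsub>tensor_ring A B\<^esub> pure_tensor A B a b'"
proof -
  interpret A: cring A by fact
  interpret B: cring B by fact
  define F where "F = integral_monoid_ring (A \<times>\<times> B)"
  define I where "I = tensor_ideal A B"
  interpret I: ideal I F
    unfolding F_def I_def by (rule ideal_tensor_ideal [OF assms])
  interpret h: ring_hom_ring F "tensor_ring A B" "(+>\<^bsub>F\<^esub>) I"
    using I.rcos_ring_hom_ring by (simp add: tensor_ring_def F_def I_def)
  have pt: "pure_tensor A B a b = I +>\<^bsub>F\<^esub> frag_of (a, b)" for a b
    by (simp add: pure_tensor_def F_def I_def)
  have cl: "frag_of (a, b) \<in> carrier F" if "a \<in> carrier A" "b \<in> carrier B" for a b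
    using that by (simp add: F_def integral_monoid_ring_def DirProd_def)
  have rel: "I +>\<^bsub>F\<^esub> x = (I +>\<^bsub>F\<^esub> y) \<oplus>\<^bsub>tensor_ring A B\<^esub> (I +>\<^bsub>F\<^esub> z)"
    if "x - y - z \<in> tensor_relations A B" "y \<in> carrier F" "z \<in> carrier F" for x y z
  proof -
    have "x - y - z \<in> I"
      using that(1) tensor_relations_subset [OF assms] by (auto simp: I_def)
    moreover have "x = (x - y - z) \<oplus>\<^bsub>F\<^esub> (y \<oplus>\<^bsub>F\<^esub> z)"
      by (simp add: F_def integral_monoid_ring_def)
    ultimately have "x \<in> I +>\<^bsub>F\<^esub> (y \<oplus>\<^bsub>F\<^esub> z)"
      by (auto simp: a_r_coset_def')
    then have "I +>\<^bsub>F\<^esub> x = I +>\<^bsub>F\<^esub> (y \<oplus>\<^bsub>F\<^esub> z)"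
      using I.a_repr_independence' [of x "y \<oplus>\<^bsub>F\<^esub> z"] that(2,3) by simp
    then show ?thesis using that(2,3) by simp
  qed
  show "pure_tensor A B a b \<in> carrier (tensor_ring A B)" if "a \<in> carrier A" "b \<in> carrier B" for a b
    using cl [OF that] by (simp add: pt)
  show "pure_tensor A B a b \<otimes>\<^bsub>tensor_ring A B\<^esub> pure_tensor A B a' b' =
      pure_tensor A B (a \<otimes>\<^bsub>A\<^esub> a') (b \<otimes>\<^bsub>B\<^esub> b')"
    if "a \<in> carrier A" "b \<in> carrier B" "a' \<in> carrier A" "b' \<in> carrier B" for a b a' b'
  proof -
    have "frag_of (a, b) \<otimes>\<^bsub>F\<^esub> frag_of (a', b') = frag_of (a \<otimes>\<^bsub>A\<^esub> a', b \<otimes>\<^bsub>B\<^esub> b')"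
      by (simp add: F_def integral_monoid_ring_def DirProd_def)
    then show ?thesis
      using h.hom_mult [OF cl [OF that(1,2)] cl [OF that(3,4)]] by (simp add: pt)
  qed
  have "frag_of (\<one>\<^bsub>A\<^esub>, \<one>\<^bsub>B\<^esub>) = \<one>\<^bsub>F\<^esub>"
    by (simp add: F_def integral_monoid_ring_def DirProd_def)
  then show "pure_tensor A B \<one>\<^bsub>A\<^esub> \<one>\<^bsub>B\<^esub> = \<one>\<^bsub>tensor_ring A B\<^esub>"
    using h.hom_one by (simp add: pt)
  show "pure_tensor A B (a \<oplus>\<^bsub>A\<^esub> a') b = pure_tensor A B a b \<oplus>\<^bsub>tensor_ring A B\<^esub> pure_tensor A B a' b"
    if "a \<in> carrier A" "a' \<in> carrier A" "b \<in> carrier B" for a a' b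
    unfolding pt by (rule rel) (use that in \<open>auto simp: cl tensor_relations_def\<close>)
  show "pure_tensor A B a (b \<oplus>\<^bsub>B\<^esub> b') = pure_tensor A B a b \<oplus>\<^bsub>tensor_ring A B\<^esub> pure_tensor A B a b'"
    if "a \<in> carrier A" "b \<in> carrier B" "b' \<in> carrier B" for a b b'
    unfolding pt by (rule rel) (use that in \<open>auto simp: cl tensor_relations_def\<close>)
qed

lemma algebra_base_change:
  assumes "cring A" "cring B"
  shows "algebra B (base_change A B)"
proof -
  interpret A: cring A by fact
  interpret B: cring B by fact
  interpret T: cring "tensor_ring A B" by (rule cring_tensor_ring [OF assms])
  note pt = pure_tensor_closed [OF assms] pure_tensor_mult [OF assms] pure_tensor_one [OF assms]
    pure_tensor_add_right [OF assms]
  note sel = base_change_def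
  have cr: "cring (base_change A B)"
  proof (rule cringI)
    show "abelian_group (base_change A B)"
    proof (rule abelian_groupI)
      fix x assume "x \<in> carrier (base_change A B)"
      then show "\<exists>y\<in>carrier (base_change A B). y \<oplus>\<^bsub>base_change A B\<^esub> x = \<zero>\<^bsub>base_change A B\<^esub>"
        by (intro bexI [of _ "\<ominus>\<^bsub>tensor_ring A B\<^esub> x"]) (auto simp: sel T.l_neg)
    qed (simp_all add: sel T.a_ac)
    show "Group.comm_monoid (base_change A B)"
      by (rule comm_monoidI) (simp_all add: sel T.m_ac)
  qed (auto simp: sel T.l_distr)
  show ?thesis
  proof (rule algebraI [OF assms(2) cr])
    fix a b x
    assume *: "a \<in> carrier B" "b \<in> carrier B" "x \<in> carrier (base_change A B)"
    have "pure_tensor A B \<one>\<^bsub>A\<^esub> (a \<otimes>\<^bsub>B\<^esub> b) =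
        pure_tensor A B \<one>\<^bsub>A\<^esub> a \<otimes>\<^bsub>tensor_ring A B\<^esub> pure_tensor A B \<one>\<^bsub>A\<^esub> b"
      using * by (simp add: pt)
    then show "(a \<otimes>\<^bsub>B\<^esub> b) \<odot>\<^bsub>base_change A B\<^esub> x = a \<odot>\<^bsub>base_change A B\<^esub> (b \<odot>\<^bsub>base_change A B\<^esub> x)"
      using * by (simp add: sel T.m_assoc pt(1))
  qed (auto simp: sel pt(1,3,4) T.l_distr T.r_distr T.m_assoc)
qed


section \<open>Integer-valued polynomials\<close>

definition int_valued_ring :: "rat poly ring"
  where "int_valued_ring =
    \<lparr>carrier = {P. \<forall>n::nat. poly P (of_nat n) \<in> \<int>},
     monoid.mult = (*),
     one = 1,
     zero = 0,
     add = (+)\<rparr>"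

definition binom_poly :: "nat \<Rightarrow> rat poly"
  where "binom_poly k = Polynomial.smult (1 / fact k) (\<Prod>i<k. [:- of_nat i, 1:])"

abbreviation int_valued_mod :: "nat \<Rightarrow> (int, ((rat poly \<times> int) \<Rightarrow>\<^sub>0 int) set) module"
  where "int_valued_mod p \<equiv> base_change int_valued_ring (residue_ring (int p))"

definition binom_mod :: "nat \<Rightarrow> nat \<Rightarrow> ((rat poly \<times> int) \<Rightarrow>\<^sub>0 int) set"
  where "binom_mod p k =
    pure_tensor int_valued_ring (residue_ring (int p)) (binom_poly k) \<one>\<^bsub>residue_ring (int p)\<^esub>"

lemma poly_binom_poly: "poly (binom_poly k) x = x gchoose k"
  by (simp add: binom_poly_def gbinomial_prod_rev poly_prod atLeast0LessThan)

lemma binom_poly_carrier: "binom_poly k \<in> carrier int_valued_ring"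
  by (simp add: int_valued_ring_def poly_binom_poly flip: binomial_gbinomial)

lemma cring_int_valued_ring: "cring int_valued_ring"
proof (rule cringI)
  show "abelian_group int_valued_ring"
  proof (rule abelian_groupI)
    fix x assume "x \<in> carrier int_valued_ring"
    then show "\<exists>y\<in>carrier int_valued_ring. y \<oplus>\<^bsub>int_valued_ring\<^esub> x = \<zero>\<^bsub>int_valued_ring\<^esub>"
      by (intro bexI [of _ "- x"]) (auto simp: int_valued_ring_def)
  qed (auto simp: int_valued_ring_def)
  show "Group.comm_monoid int_valued_ring"
    by (rule comm_monoidI) (auto simp: int_valued_ring_def)
qed (auto simp: int_valued_ring_def algebra_simps)


section \<open>Linear maps\<close>

text \<open>Maps are taken extensional (undefined outside the carrier), so that uniqueness of a map is
  meaningful.\<close>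

definition linear_maps ::
    "('a, 'm) ring_scheme \<Rightarrow> ('a, 'b, 'n) module_scheme \<Rightarrow> ('a, 'c, 'o) module_scheme \<Rightarrow> ('b \<Rightarrow> 'c) set"
  where "linear_maps K M N =
    {f \<in> carrier M \<rightarrow>\<^sub>E carrier N.
       (\<forall>s\<in>carrier M. \<forall>t\<in>carrier M. f (s \<oplus>\<^bsub>M\<^esub> t) = f s \<oplus>\<^bsub>N\<^esub> f t) \<and>
       (\<forall>c\<in>carrier K. \<forall>t\<in>carrier M. f (c \<odot>\<^bsub>M\<^esub> t) = c \<odot>\<^bsub>N\<^esub> f t)}"

text \<open>The \<open>F\<^sub>p\<close>-linear endomaps of \<open>\<R> \<otimes> F\<^sub>p\<close> sending \<open>binom x k\<close> to \<open>g k\<close> for every \<open>k\<close>.\<close>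

definition linear_extensions ::
    "nat \<Rightarrow> (nat \<Rightarrow> ((rat poly \<times> int) \<Rightarrow>\<^sub>0 int) set) \<Rightarrow>
      (((rat poly \<times> int) \<Rightarrow>\<^sub>0 int) set \<Rightarrow> ((rat poly \<times> int) \<Rightarrow>\<^sub>0 int) set) set"
  where "linear_extensions p g =
    {f \<in> linear_maps (residue_ring (int p)) (int_valued_mod p) (int_valued_mod p).
       \<forall>k. f (binom_mod p k) = g k}"

abbreviation Psi_maps where
  "Psi_maps p \<equiv> linear_extensions p (\<lambda>k. binom_mod p (p * k))"

abbreviation Psi_tilde_maps where
  "Psi_tilde_maps p \<equiv> linear_extensions p
     (\<lambda>k. if p dvd k then binom_mod p (k div p) else \<zero>\<^bsub>int_valued_mod p\<^esub>)"

end

theory Submission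
  imports Defs
begin

text \<open>For each \<open>n\<close>, evaluation at \<open>n\<close> is a ring homomorphism \<open>ev\<^sub>n : \<R> \<otimes> F\<^sub>p \<rightarrow> F\<^sub>p\<close>, \<open>P \<otimes> c \<mapsto> c P(n)\<close>.
So every \<open>t\<close> gives a function \<open>n \<mapsto> ev\<^sub>n t\<close> on \<open>\<nat>\<close>, and under this ring homomorphism \<open>\<Psi>\<^sub>p\<close> becomes a change of
variable: by the case of Lucas' theorem \<open>binom n (p k) \<equiv> binom (n div p) k\<close> modulo \<open>p\<close>
(\<open>binomial_prime_mult_cong\<close>), \<open>ev\<^sub>n \<circ> \<Psi>\<^sub>p\<close> and \<open>ev\<close> at \<open>n div p\<close> agree on the elements \<open>binom x k\<close>, hence
everywhere (\<open>point_value_Psi\<close>). Substituting \<open>n div p\<close> for \<open>n\<close> respects products of functions, so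
\<open>\<Psi>\<^sub>p\<close> is a ring homomorphism as soon as an element of \<open>\<R> \<otimes> F\<^sub>p\<close> is determined by its function
(\<open>point_value_separates\<close>).

Determinacy and the existence of \<open>\<Psi>\<^sub>p\<close> and of its left inverse both come from the fact that the
\<open>binom x k\<close> form a basis. They span because an integer-valued polynomial is an integral
combination of binomial polynomials (\<open>int_valued_eq_sum_binom_poly\<close>). They are independent because
they have a dual family: the \<open>k\<close>-th forward difference at \<open>0\<close> of \<open>n \<mapsto> ev\<^sub>n t\<close> is a linear functional
that takes the value \<open>1\<close> on \<open>binom x k\<close> and \<open>0\<close> on the others. As these coordinates are computed
from the values \<open>ev\<^sub>n t\<close>, the values determine \<open>t\<close>. Finally, the composite of the two maps
fixes every \<open>binom x k\<close>, so it is the identity.\<close>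

section \<open>Linear maps and dual bases\<close>

text \<open>Adding one multiple of a generator at a time turns statements about linear combinations into inductions.\<close>

inductive_set lin_span :: "('a, 'm) ring_scheme \<Rightarrow> ('a, 'b, 'n) module_scheme \<Rightarrow> ('i \<Rightarrow> 'b) \<Rightarrow> 'b set"
  for K M b where
  zero: "\<zero>\<^bsub>M\<^esub> \<in> lin_span K M b"
| step: "\<lbrakk>t \<in> lin_span K M b; c \<in> carrier K\<rbrakk> \<Longrightarrow> t \<oplus>\<^bsub>M\<^esub> c \<odot>\<^bsub>M\<^esub> b k \<in> lin_span K M b"

lemma linear_maps_closed: "\<lbrakk>f \<in> linear_maps K M N; t \<in> carrier M\<rbrakk> \<Longrightarrow> f t \<in> carrier N"
  and linear_maps_add: "\<lbrakk>f \<in> linear_maps K M N; s \<in> carrier M; t \<in> carrier M\<rbrakk> \<Longrightarrow>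
    f (s \<oplus>\<^bsub>M\<^esub> t) = f s \<oplus>\<^bsub>N\<^esub> f t"
  and linear_maps_smult: "\<lbrakk>f \<in> linear_maps K M N; c \<in> carrier K; t \<in> carrier M\<rbrakk> \<Longrightarrow>
    f (c \<odot>\<^bsub>M\<^esub> t) = c \<odot>\<^bsub>N\<^esub> f t"
  by (auto simp: linear_maps_def)

lemma linear_maps_zero:
  assumes "abelian_group M" "abelian_group N" "f \<in> linear_maps K M N"
  shows "f \<zero>\<^bsub>M\<^esub> = \<zero>\<^bsub>N\<^esub>"
proof -
  interpret M: abelian_group M by fact
  interpret N: abelian_group N by fact
  have "f \<zero>\<^bsub>M\<^esub> \<oplus>\<^bsub>N\<^esub> f \<zero>\<^bsub>M\<^esub> = f \<zero>\<^bsub>M\<^esub>"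
    using linear_maps_add [OF assms(3), of "\<zero>\<^bsub>M\<^esub>" "\<zero>\<^bsub>M\<^esub>"] by simp
  then show ?thesis
    using linear_maps_closed [OF assms(3), of "\<zero>\<^bsub>M\<^esub>"] N.add.l_cancel_one by simp
qed

lemma (in module) lin_span_closed:
  assumes "range b \<subseteq> carrier M" "t \<in> lin_span R M b"
  shows "t \<in> carrier M"
  using assms(2) by induction (use assms(1) in auto)

lemma linear_maps_eq_on_span:
  assumes "module K M" "module K N" "f \<in> linear_maps K M N" "g \<in> linear_maps K M N"
    and "range b \<subseteq> carrier M" "\<And>k. f (b k) = g (b k)" "t \<in> lin_span K M b"
  shows "f t = g t"
proof -
  interpret M: module K M by fact
  interpret N: module K N by fact
  show ?thesis using assms(7)
  proof induction
    case zero
    then show ?case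
      using linear_maps_zero [OF M.abelian_group_axioms N.abelian_group_axioms assms(3)]
        linear_maps_zero [OF M.abelian_group_axioms N.abelian_group_axioms assms(4)] by simp
  next
    case (step t c k)
    then have "t \<in> carrier M" using M.lin_span_closed assms(5) by blast
    moreover have "b k \<in> carrier M" using assms(5) by auto
    ultimately show ?case
      using step assms(3,4,6) by (simp add: linear_maps_add linear_maps_smult)
  qed
qed

lemma linear_maps_ident:
  assumes "module K M"
  shows "(\<lambda>t\<in>carrier M. t) \<in> linear_maps K M M"
proof -
  interpret module K M by fact
  show ?thesis by (auto simp: linear_maps_def)
qed

lemma linear_maps_compose:
  assumes "module K M" "f \<in> linear_maps K M N" "g \<in> linear_maps K N P"
  shows "(\<lambda>t\<in>carrier M. g (f t)) \<in> linear_maps K M P"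
proof -
  interpret module K M by fact
  note lin = assms(2,3)
  show ?thesis
    by (auto simp: linear_maps_def [of K M P] linear_maps_closed [OF lin(1)] linear_maps_closed [OF lin(2)]
        linear_maps_add [OF lin(1)] linear_maps_add [OF lin(2)]
        linear_maps_smult [OF lin(1)] linear_maps_smult [OF lin(2)])
qed

context module
begin

lemma lin_span_add:
  assumes "range b \<subseteq> carrier M" "s \<in> lin_span R M b" "t \<in> lin_span R M b"
  shows "s \<oplus>\<^bsub>M\<^esub> t \<in> lin_span R M b"
  using assms(3)
proof induction
  case zero
  then show ?case using assms(2) lin_span_closed [OF assms(1,2)] by simp
next
  case (step t c k)
  have "s \<in> carrier M" "t \<in> carrier M" "b k \<in> carrier M"
    using lin_span_closed [OF assms(1)] assms(1,2) step(1) by auto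
  then show ?case
    using lin_span.step [OF step(3,2), of k] step(2) by (simp add: M.a_assoc)
qed

lemma lin_span_minus:
  assumes "range b \<subseteq> carrier M" "t \<in> lin_span R M b"
  shows "\<ominus>\<^bsub>M\<^esub> t \<in> lin_span R M b"
  using assms(2)
proof induction
  case zero
  have "\<ominus>\<^bsub>M\<^esub> \<zero>\<^bsub>M\<^esub> = \<zero>\<^bsub>M\<^esub>" by (rule M.minus_equality) simp_all
  then show ?case by (simp only: lin_span.zero)
next
  case (step t c k)
  have "t \<in> carrier M" "b k \<in> carrier M"
    using lin_span_closed [OF assms(1)] assms(1) step(1) by auto
  then show ?case
    using lin_span.step [OF step(3), of "\<ominus> c" k] step(2)
    by (simp add: M.minus_add smult_l_minus)
qed

end

text \<open>A spanning family \<open>b\<close> with linear functionals \<open>coord k\<close> satisfying \<open>coord k (b j) = \<delta>\<close>. Such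
functionals force \<open>b\<close> to be a basis, and unlike bare linear independence they come with a formula for
the coordinates.\<close>

locale dual_basis = module K M
  for K :: "('a, 'm) ring_scheme" (structure) and M :: "('a, 'c, 'n) module_scheme" (structure) +
  fixes b :: "'i \<Rightarrow> 'c" and coord :: "'i \<Rightarrow> 'c \<Rightarrow> 'a"
  assumes basis_closed: "range b \<subseteq> carrier M"
    and spanning: "carrier M \<subseteq> lin_span K M b"
    and coord_closed: "t \<in> carrier M \<Longrightarrow> coord k t \<in> carrier K"
    and coord_add: "\<lbrakk>s \<in> carrier M; t \<in> carrier M\<rbrakk> \<Longrightarrow> coord k (s \<oplus>\<^bsub>M\<^esub> t) = coord k s \<oplus>\<^bsub>K\<^esub> coord k t"
    and coord_smult: "\<lbrakk>c \<in> carrier K; t \<in> carrier M\<rbrakk> \<Longrightarrow> coord k (c \<odot>\<^bsub>M\<^esub> t) = c \<otimes>\<^bsub>K\<^esub> coord k t"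
    and coord_basis: "coord k (b j) = (if k = j then \<one>\<^bsub>K\<^esub> else \<zero>\<^bsub>K\<^esub>)"
begin

definition extension :: "('a, 'd, 'o) module_scheme \<Rightarrow> ('i \<Rightarrow> 'd) \<Rightarrow> 'c \<Rightarrow> 'd"
  where "extension N g =
    (\<lambda>t\<in>carrier M. finsum N (\<lambda>k. coord k t \<odot>\<^bsub>N\<^esub> g k) {k. coord k t \<noteq> \<zero>\<^bsub>K\<^esub>})"

lemma coord_zero: "coord k \<zero>\<^bsub>M\<^esub> = \<zero>\<^bsub>K\<^esub>"
proof -
  have "coord k \<zero>\<^bsub>M\<^esub> \<oplus>\<^bsub>K\<^esub> coord k \<zero>\<^bsub>M\<^esub> = coord k \<zero>\<^bsub>M\<^esub>"
    using coord_add [of "\<zero>\<^bsub>M\<^esub>" "\<zero>\<^bsub>M\<^esub>"] by simp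
  then show ?thesis
    using coord_closed [of "\<zero>\<^bsub>M\<^esub>" k] R.add.l_cancel_one by simp
qed

lemma finite_support:
  assumes "t \<in> carrier M"
  shows "finite {k. coord k t \<noteq> \<zero>\<^bsub>K\<^esub>}"
proof -
  from assms spanning have "t \<in> lin_span K M b" by blast
  then show ?thesis
  proof induction
    case zero
    then show ?case by (simp add: coord_zero)
  next
    case (step t c k)
    have t: "t \<in> carrier M" "b k \<in> carrier M"
      using lin_span_closed [OF basis_closed step(1)] basis_closed by auto
    have "{j. coord j (t \<oplus>\<^bsub>M\<^esub> c \<odot>\<^bsub>M\<^esub> b k) \<noteq> \<zero>\<^bsub>K\<^esub>} \<subseteq> insert k {j. coord j t \<noteq> \<zero>\<^bsub>K\<^esub>}"
      using t step(2) by (auto simp: coord_add coord_smult coord_basis)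
    then show ?case using step(3) finite_subset by blast
  qed
qed

text \<open>The index set of the sum in \<open>extension\<close> varies with \<open>t\<close>; to compare the sums of several elements,
they are all taken over a common larger set.\<close>

lemma extension_eq_finsum:
  assumes "module K N" "range g \<subseteq> carrier N" "t \<in> carrier M"
    and "finite A" "{k. coord k t \<noteq> \<zero>\<^bsub>K\<^esub>} \<subseteq> A"
  shows "extension N g t = finsum N (\<lambda>k. coord k t \<odot>\<^bsub>N\<^esub> g k) A"
proof -
  interpret N: module K N by fact
  show ?thesis
    unfolding extension_def using assms
    by (auto intro!: N.add.finprod_mono_neutral_cong_left simp: coord_closed image_subset_iff)
qed

lemma extension_linear:
  assumes "module K N" "range g \<subseteq> carrier N"
  shows "extension N g \<in> linear_maps K M N"
proof -
  interpret N: module K N by fact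
  have g: "g k \<in> carrier N" for k using assms(2) by auto
  note eq = extension_eq_finsum [OF assms]
  have "extension N g (s \<oplus>\<^bsub>M\<^esub> t) = extension N g s \<oplus>\<^bsub>N\<^esub> extension N g t"
    if s: "s \<in> carrier M" and t: "t \<in> carrier M" for s t
  proof -
    define A where "A = {k. coord k s \<noteq> \<zero>\<^bsub>K\<^esub>} \<union> {k. coord k t \<noteq> \<zero>\<^bsub>K\<^esub>}"
    have A: "finite A" using s t by (simp add: A_def finite_support)
    have sub: "{k. coord k (s \<oplus>\<^bsub>M\<^esub> t) \<noteq> \<zero>\<^bsub>K\<^esub>} \<subseteq> A"
      using s t by (auto simp: A_def coord_add coord_closed)
    have "extension N g (s \<oplus>\<^bsub>M\<^esub> t) = finsum N (\<lambda>k. coord k (s \<oplus>\<^bsub>M\<^esub> t) \<odot>\<^bsub>N\<^esub> g k) A"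
      using eq [OF _ A sub] s t by simp
    also have "\<dots> = finsum N (\<lambda>k. coord k s \<odot>\<^bsub>N\<^esub> g k \<oplus>\<^bsub>N\<^esub> coord k t \<odot>\<^bsub>N\<^esub> g k) A"
      using s t g by (intro N.finsum_cong') (auto simp: coord_add coord_closed N.smult_l_distr)
    also have "\<dots> = extension N g s \<oplus>\<^bsub>N\<^esub> extension N g t"
      using s t g eq [OF s A] eq [OF t A]
      by (subst N.finsum_addf) (auto simp: coord_closed A_def)
    finally show ?thesis .
  qed
  moreover have "extension N g (c \<odot>\<^bsub>M\<^esub> t) = c \<odot>\<^bsub>N\<^esub> extension N g t"
    if c: "c \<in> carrier K" and t: "t \<in> carrier M" for c t
  proof -
    let ?A = "{k. coord k t \<noteq> \<zero>\<^bsub>K\<^esub>}"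
    have A: "finite ?A" using t by (rule finite_support)
    have sub: "{k. coord k (c \<odot>\<^bsub>M\<^esub> t) \<noteq> \<zero>\<^bsub>K\<^esub>} \<subseteq> ?A"
      using c t by (auto simp: coord_smult)
    have "extension N g (c \<odot>\<^bsub>M\<^esub> t) = finsum N (\<lambda>k. coord k (c \<odot>\<^bsub>M\<^esub> t) \<odot>\<^bsub>N\<^esub> g k) ?A"
      using eq [OF _ A sub] c t by simp
    also have "\<dots> = finsum N (\<lambda>k. c \<odot>\<^bsub>N\<^esub> (coord k t \<odot>\<^bsub>N\<^esub> g k)) ?A"
      using c t g by (intro N.finsum_cong') (auto simp: coord_smult coord_closed N.smult_assoc1)
    also have "\<dots> = c \<odot>\<^bsub>N\<^esub> extension N g t"
      using c t g eq [OF t A] A by (simp add: N.finsum_smult_ldistr coord_closed)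
    finally show ?thesis .
  qed
  moreover have "extension N g \<in> carrier M \<rightarrow>\<^sub>E carrier N"
    unfolding extension_def using g by (auto intro!: N.finsum_closed simp: coord_closed)
  ultimately show ?thesis by (auto simp: linear_maps_def)
qed

lemma extension_basis:
  assumes "module K N" "range g \<subseteq> carrier N"
  shows "extension N g (b k) = g k"
proof -
  interpret N: module K N by fact
  have g: "g k \<in> carrier N" and b: "b k \<in> carrier M"
    using assms(2) basis_closed by auto
  have "extension N g (b k) = finsum N (\<lambda>j. coord j (b k) \<odot>\<^bsub>N\<^esub> g j) {k}"
    by (rule extension_eq_finsum [OF assms b]) (auto simp: coord_basis)
  then show ?thesis using g by (simp add: coord_basis)
qed

lemma ex1_linear_extension:
  assumes "module K N" "range g \<subseteq> carrier N"
  shows "\<exists>!f. f \<in> linear_maps K M N \<and> (\<forall>k. f (b k) = g k)"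
proof (rule ex1I [of _ "extension N g"])
  show "extension N g \<in> linear_maps K M N \<and> (\<forall>k. extension N g (b k) = g k)"
    using extension_linear extension_basis assms by blast
next
  fix f assume f: "f \<in> linear_maps K M N \<and> (\<forall>k. f (b k) = g k)"
  show "f = extension N g"
  proof (rule PiE_ext)
    show "f \<in> carrier M \<rightarrow>\<^sub>E carrier N" "extension N g \<in> carrier M \<rightarrow>\<^sub>E carrier N"
      using f extension_linear [OF assms] by (auto simp: linear_maps_def)
    show "f t = extension N g t" if "t \<in> carrier M" for t
      by (rule linear_maps_eq_on_span [OF module_axioms assms(1) _ extension_linear [OF assms] basis_closed])
         (use that f spanning in \<open>auto simp: extension_basis [OF assms]\<close>)
  qed
qed

text \<open>The extension of \<open>b\<close> itself is the identity, so each element is recovered from its coordinates.\<close>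

lemma coord_separates:
  assumes "s \<in> carrier M" "t \<in> carrier M" "\<And>k. coord k s = coord k t"
  shows "s = t"
proof -
  have id: "extension M b r = r" if "r \<in> carrier M" for r
  proof -
    have "extension M b r = (\<lambda>x\<in>carrier M. x) r"
      by (rule linear_maps_eq_on_span [OF module_axioms module_axioms
            extension_linear [OF module_axioms basis_closed] linear_maps_ident [OF module_axioms]
            basis_closed])
         (use that spanning basis_closed in
           \<open>auto simp: extension_basis [OF module_axioms basis_closed]\<close>)
    then show ?thesis using that by simp
  qed
  have "extension M b s = extension M b t"
    unfolding extension_def using assms by simp
  then show ?thesis using id assms by simp
qed

end

section \<open>Forward differences and binomial coefficients modulo a prime\<close>

definition forward_diff :: "(nat \<Rightarrow> int) \<Rightarrow> nat \<Rightarrow> int"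
  where "forward_diff f n = f (Suc n) - f n"

lemma forward_diff_funpow_Suc:
  "(forward_diff ^^ Suc k) f n = (forward_diff ^^ k) f (Suc n) - (forward_diff ^^ k) f n"
  by (simp add: forward_diff_def)

lemma forward_diff_funpow_add:
  "(forward_diff ^^ k) (\<lambda>n. f n + g n) n = (forward_diff ^^ k) f n + (forward_diff ^^ k) g n"
  by (induction k arbitrary: n) (simp_all add: forward_diff_funpow_Suc del: funpow.simps(2))

lemma forward_diff_funpow_cmult:
  "(forward_diff ^^ k) (\<lambda>n. c * f n) n = c * (forward_diff ^^ k) f n"
  by (induction k arbitrary: n)
     (simp_all add: forward_diff_funpow_Suc right_diff_distrib del: funpow.simps(2))

lemma forward_diff_funpow_cong:
  assumes "\<And>n. [f n = g n] (mod m)"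
  shows "[(forward_diff ^^ k) f n = (forward_diff ^^ k) g n] (mod m)"
proof (induction k arbitrary: n)
  case (Suc k)
  show ?case unfolding forward_diff_funpow_Suc by (intro cong_diff Suc.IH)
qed (simp add: assms)

text \<open>Each difference lowers the lower index by one, by Pascal's rule; the constant \<open>binom n 0\<close> is then
killed. At \<open>n = 0\<close> only the case \<open>k = j\<close> leaves a non-zero value.\<close>

lemma forward_diff_funpow_binomial:
  "(forward_diff ^^ k) (\<lambda>n. int (n choose j)) n = (if k \<le> j then int (n choose (j - k)) else 0)"
proof (induction k arbitrary: n)
  case (Suc k)
  show ?case
  proof (cases "k < j")
    case True
    then obtain d where "j = Suc (k + d)" using less_imp_Suc_add by blast
    then show ?thesis unfolding forward_diff_funpow_Suc Suc.IH by (simp add: Suc_diff_le)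
  next
    case False
    then show ?thesis unfolding forward_diff_funpow_Suc Suc.IH by auto
  qed
qed simp

lemma forward_diff_funpow_binomial_0:
  "(forward_diff ^^ k) (\<lambda>n. int (n choose j)) 0 = (if k = j then 1 else 0)"
  by (simp add: forward_diff_funpow_binomial)

text \<open>This is \<open>(1 + X)\<^sup>p \<equiv> 1 + X\<^sup>p\<close> read off from the coefficients of \<open>(1 + X)\<^sup>p (1 + X)\<^sup>n\<close>: in Vandermonde's
convolution, \<open>p\<close> divides every \<open>binom p i\<close> but the first and the last.\<close>

lemma binomial_add_prime_cong:
  fixes p :: nat
  assumes "Factorial_Ring.prime p"
  shows "[(p + n) choose (p + r) = (n choose (p + r)) + (n choose r)] (mod p)"
proof -
  have p: "p > 0" using assms prime_gt_0_nat by blast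
  have "(p + n) choose (p + r) = (\<Sum>i\<le>p + r. (p choose i) * (n choose (p + r - i)))"
    by (rule vandermonde [symmetric])
  also have "[\<dots> = (\<Sum>i\<le>p + r. if i \<in> {0, p} then n choose (p + r - i) else 0)] (mod p)"
  proof (rule cong_sum)
    fix i assume "i \<in> {..p + r}"
    consider "i = 0" | "i = p" | "0 < i" "i < p" | "p < i" by linarith
    then show "[(p choose i) * (n choose (p + r - i)) =
        (if i \<in> {0, p} then n choose (p + r - i) else 0)] (mod p)"
    proof cases
      case 3
      then have "p dvd p choose i" using assms dvd_choose_prime [of i p] by simp
      then show ?thesis using 3 by (simp add: cong_0_iff)
    qed (use p in \<open>auto simp: binomial_eq_0\<close>)
  qed
  also have "(\<Sum>i\<le>p + r. if i \<in> {0, p} then n choose (p + r - i) else 0) =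
      (\<Sum>i\<in>{0, p}. n choose (p + r - i))"
    by (intro sum.mono_neutral_cong_right) auto
  also have "\<dots> = (n choose (p + r)) + (n choose r)" using p by simp
  finally show ?thesis .
qed

text \<open>Modulo \<open>p\<close>, increasing \<open>n\<close> by \<open>p\<close> acts on both sides by Pascal's rule in \<open>k\<close>, and they agree for
\<open>n < p\<close>.\<close>

lemma binomial_prime_mult_cong:
  fixes p :: nat
  assumes "Factorial_Ring.prime p"
  shows "[n choose (p * k) = (n div p) choose k] (mod p)"
proof -
  have p: "p > 0" using assms prime_gt_0_nat by blast
  show ?thesis
  proof (induction n arbitrary: k rule: less_induct)
    case (less n)
    show ?case
    proof (cases "n < p")
      case True
      then show ?thesis using p by (cases k) (auto simp: binomial_eq_0)
    next
      case False
      then obtain m where m: "n = p + m" using le_Suc_ex [of p n] by auto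
      show ?thesis
      proof (cases k)
        case (Suc l)
        have "[n choose (p * k) = (m choose (p * k)) + (m choose (p * l))] (mod p)"
          using binomial_add_prime_cong [OF assms, of m "p * l"] by (simp add: m Suc)
        also have "[(m choose (p * k)) + (m choose (p * l)) =
            ((m div p) choose k) + ((m div p) choose l)] (mod p)"
          using p m by (intro cong_add less) auto
        also have "((m div p) choose k) + ((m div p) choose l) = (n div p) choose k"
          using p by (simp add: m Suc)
        finally show ?thesis .
      qed simp
    qed
  qed
qed

lemma int_valued_poly_of_nat:
  "P \<in> carrier int_valued_ring \<Longrightarrow> poly P (of_nat n) = of_int \<lfloor>poly P (of_nat n)\<rfloor>"
  by (auto simp: int_valued_ring_def elim!: Ints_cases)

lemma degree_binom_poly_le: "degree (binom_poly k) \<le> k"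
  unfolding binom_poly_def
  by (intro order.trans [OF degree_smult_le] order.trans [OF degree_prod_sum_le]) auto

text \<open>The binomial functions are unitriangular on \<open>\<nat>\<close>: \<open>binom n N\<close> vanishes for \<open>n < N\<close> and is \<open>1\<close> at
\<open>n = N\<close>, so the value at \<open>N\<close> can be corrected without spoiling the earlier ones or dividing.\<close>

lemma int_combination_interpolates:
  fixes f :: "nat \<Rightarrow> int"
  shows "\<exists>z. \<forall>n<N. (\<Sum>k<N. z k * int (n choose k)) = f n"
proof (induction N)
  case (Suc N)
  then obtain z where z: "\<And>n. n < N \<Longrightarrow> (\<Sum>k<N. z k * int (n choose k)) = f n" by blast
  define z' where "z' = z(N := f N - (\<Sum>k<N. z k * int (N choose k)))"
  have "(\<Sum>k<N. z' k * int (n choose k)) = (\<Sum>k<N. z k * int (n choose k))" for n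
    by (rule sum.cong) (auto simp: z'_def)
  then have "(\<Sum>k<Suc N. z' k * int (n choose k)) = f n" if "n < Suc N" for n
    using that z by (cases "n = N") (auto simp: z'_def)
  then show ?case by blast
qed simp

text \<open>Interpolating the values at \<open>0, \<dots>, deg P\<close> yields a polynomial of degree at most \<open>deg P\<close>, which
must be \<open>P\<close>.\<close>

lemma int_valued_eq_sum_binom_poly:
  assumes "P \<in> carrier int_valued_ring"
  obtains N z where "P = (\<Sum>k<N. of_int (z k) * binom_poly k)"
proof -
  define N where "N = Suc (degree P)"
  obtain z where z: "\<And>n. n < N \<Longrightarrow> (\<Sum>k<N. z k * int (n choose k)) = \<lfloor>poly P (of_nat n)\<rfloor>"
    using int_combination_interpolates [of N "\<lambda>n. \<lfloor>poly P (of_nat n)\<rfloor>"] by blast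
  define Q where "Q = (\<Sum>k<N. of_int (z k) * binom_poly k)"
  have Qv: "poly Q (of_nat n) = of_int (\<Sum>k<N. z k * int (n choose k))" for n
    by (simp add: Q_def poly_sum poly_binom_poly flip: binomial_gbinomial)
  have "degree Q \<le> degree P"
    unfolding Q_def
  proof (rule degree_sum_le)
    fix k assume "k \<in> {..<N}"
    have "degree (of_int (z k) * binom_poly k) \<le> degree (binom_poly k)"
      using degree_mult_le [of "of_int (z k)" "binom_poly k"] by simp
    also have "\<dots> \<le> degree P"
      using degree_binom_poly_le [of k] \<open>k \<in> _\<close> by (simp add: N_def)
    finally show "degree (of_int (z k) * binom_poly k) \<le> degree P" .
  qed simp
  have "P = Q"
  proof (rule poly_eqI_degree)
    show "poly P x = poly Q x" if "x \<in> of_nat ` {..<N}" for x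
    proof -
      from that obtain n where "n < N" "x = of_nat n" by auto
      then show ?thesis
        unfolding \<open>x = of_nat n\<close> Qv z [OF \<open>n < N\<close>] by (intro int_valued_poly_of_nat assms)
    qed
    show "degree P < card (of_nat ` {..<N} :: rat set)" "degree Q < card (of_nat ` {..<N} :: rat set)"
      using \<open>degree Q \<le> degree P\<close> by (simp_all add: card_image N_def inj_on_def)
  qed
  then show ?thesis using that Q_def by blast
qed

section \<open>Evaluation of formal sums\<close>

text \<open>A homomorphism that vanishes on an ideal is constant on its cosets, so it induces a homomorphism on the
quotient. The ideal may be smaller than the kernel.\<close>

lemma
  assumes "ideal I R" "ring S" "h \<in> ring_hom R S" "\<And>x. x \<in> I \<Longrightarrow> h x = \<zero>\<^bsub>S\<^esub>"
  shows the_elem_image_coset: "x \<in> carrier R \<Longrightarrow> the_elem (h ` (I +>\<^bsub>R\<^esub> x)) = h x"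
    and the_elem_quotient_ring_hom: "(\<lambda>X. the_elem (h ` X)) \<in> ring_hom (R Quot I) S"
proof -
  interpret I: ideal I R by fact
  interpret S: ring S by fact
  interpret h: ring_hom_ring R S h
    using assms(3) by (intro ring_hom_ringI2 I.ring_axioms) unfold_locales
  interpret q: ring_hom_ring R "R Quot I" "(+>\<^bsub>R\<^esub>) I"
    by (rule I.rcos_ring_hom_ring)
  show val: "the_elem (h ` (I +>\<^bsub>R\<^esub> x)) = h x" if x: "x \<in> carrier R" for x
  proof (rule the_elem_image_unique)
    have "x \<in> I +>\<^bsub>R\<^esub> x" by (rule I.a_rcos_self [OF x])
    then show "I +>\<^bsub>R\<^esub> x \<noteq> {}" by blast
    fix y assume "y \<in> I +>\<^bsub>R\<^esub> x"
    then obtain i where "i \<in> I" "y = i \<oplus>\<^bsub>R\<^esub> x" by (auto simp: a_r_coset_def')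
    then show "h y = h x" using x assms(4) I.Icarr by simp
  qed
  have rep: "\<exists>x\<in>carrier R. X = I +>\<^bsub>R\<^esub> x" if "X \<in> carrier (R Quot I)" for X
    using that unfolding FactRing_def A_RCOSETS_def' partial_object.simps by blast
  show "(\<lambda>X. the_elem (h ` X)) \<in> ring_hom (R Quot I) S"
  proof (rule ring_hom_memI)
    fix X assume "X \<in> carrier (R Quot I)"
    then show "the_elem (h ` X) \<in> carrier S" using rep val h.hom_closed by metis
  next
    fix X Y assume X: "X \<in> carrier (R Quot I)" and Y: "Y \<in> carrier (R Quot I)"
    obtain x where x: "x \<in> carrier R" "X = I +>\<^bsub>R\<^esub> x" using rep [OF X] by blast
    obtain y where y: "y \<in> carrier R" "Y = I +>\<^bsub>R\<^esub> y" using rep [OF Y] by blast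
    show "the_elem (h ` (X \<otimes>\<^bsub>R Quot I\<^esub> Y)) = the_elem (h ` X) \<otimes>\<^bsub>S\<^esub> the_elem (h ` Y)"
      using x(1) y(1) val [of "x \<otimes>\<^bsub>R\<^esub> y"] val [of x] val [of y] by (simp add: x(2) y(2))
    show "the_elem (h ` (X \<oplus>\<^bsub>R Quot I\<^esub> Y)) = the_elem (h ` X) \<oplus>\<^bsub>S\<^esub> the_elem (h ` Y)"
      using x(1) y(1) val [of "x \<oplus>\<^bsub>R\<^esub> y"] val [of x] val [of y] by (simp add: x(2) y(2))
  next
    show "the_elem (h ` \<one>\<^bsub>R Quot I\<^esub>) = \<one>\<^bsub>S\<^esub>"
      using val [of "\<one>\<^bsub>R\<^esub>"] by simp
  qed
qed

text \<open>The value at \<open>n\<close> of a formal sum of pairs \<open>(P, c)\<close>, before reduction modulo \<open>p\<close>. The floor only converts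
the type: \<open>poly P n\<close> is an integer when \<open>P\<close> is integer-valued.\<close>

definition frag_value :: "nat \<Rightarrow> ((rat poly \<times> int) \<Rightarrow>\<^sub>0 int) \<Rightarrow> int"
  where "frag_value n f =
    (\<Sum>x\<in>Poly_Mapping.keys f. Poly_Mapping.lookup f x * (\<lfloor>poly (fst x) (of_nat n)\<rfloor> * snd x))"

lemma frag_value_frag_of [simp]: "frag_value n (frag_of (P, c)) = \<lfloor>poly P (of_nat n)\<rfloor> * c"
  by (simp add: frag_value_def)

lemma frag_value_superset:
  assumes "finite A" "Poly_Mapping.keys f \<subseteq> A"
  shows "frag_value n f = (\<Sum>x\<in>A. Poly_Mapping.lookup f x * (\<lfloor>poly (fst x) (of_nat n)\<rfloor> * snd x))"
  unfolding frag_value_def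
  by (rule sum.mono_neutral_left [OF assms]) (auto simp: in_keys_iff)

lemma frag_value_zero [simp]: "frag_value n 0 = 0"
  by (simp add: frag_value_def)

lemma frag_value_add: "frag_value n (f + g) = frag_value n f + frag_value n g"
proof -
  let ?A = "Poly_Mapping.keys f \<union> Poly_Mapping.keys g"
  have "Poly_Mapping.keys (f + g) \<subseteq> ?A" by (rule keys_add)
  then show ?thesis
    by (simp add: frag_value_superset [of ?A] lookup_add distrib_right sum.distrib)
qed

lemma frag_value_diff: "frag_value n (f - g) = frag_value n f - frag_value n g"
  using frag_value_add [of n "f - g" g] by simp

text \<open>Only a congruence, because the second components of pairs are multiplied modulo \<open>m\<close>.\<close>

lemma frag_value_mult_cong:
  assumes "Poly_Mapping.keys f \<subseteq> carrier (int_valued_ring \<times>\<times> residue_ring m)"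
    and "Poly_Mapping.keys g \<subseteq> carrier (int_valued_ring \<times>\<times> residue_ring m)"
  shows "[frag_value n (monoid_ring_mult (int_valued_ring \<times>\<times> residue_ring m) f g) =
    frag_value n f * frag_value n g] (mod m)"
  using assms(1)
proof (induction f rule: frag_induction)
  case (one x)
  obtain P c where x: "x = (P, c)" by force
  show ?case using assms(2)
  proof (induction g rule: frag_induction)
    case (one y)
    obtain Q d where y: "y = (Q, d)" by force
    have PQ: "P \<in> carrier int_valued_ring" "Q \<in> carrier int_valued_ring"
      using one \<open>x \<in> _\<close> by (auto simp: x y DirProd_def)
    obtain i j where ij: "poly P (of_nat n) = of_int i" "poly Q (of_nat n) = of_int j"
      using PQ by (metis int_valued_poly_of_nat)
    have "\<lfloor>of_int i * of_int j :: rat\<rfloor> = i * j"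
      by (simp flip: of_int_mult)
    moreover have "[i * j * (c * d mod m) = i * j * (c * d)] (mod m)"
      by (intro cong_mult cong_refl) (simp add: cong_def)
    ultimately show ?case
      by (simp add: x y DirProd_def int_valued_ring_def residue_ring_def ij ac_simps)
  qed (simp_all add: monoid_ring_mult_diff_right frag_value_diff right_diff_distrib cong_diff)
qed (simp_all add: monoid_ring_mult_diff_left frag_value_diff left_diff_distrib cong_diff)

lemma frag_value_tensor_relations:
  assumes "f \<in> tensor_relations int_valued_ring (residue_ring m)"
  shows "[frag_value n f = 0] (mod m)"
proof -
  have floor_add: "\<lfloor>poly P (of_nat n) + poly Q (of_nat n)\<rfloor> =
      \<lfloor>poly P (of_nat n)\<rfloor> + \<lfloor>poly Q (of_nat n)\<rfloor>"
    if P: "P \<in> carrier int_valued_ring" for P Q :: "rat poly"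
  proof -
    obtain i where "poly P (of_nat n) = of_int i" using int_valued_poly_of_nat [OF P] by blast
    then show ?thesis by simp
  qed
  from assms consider
    (left) P Q c where "f = frag_of (P + Q, c) - frag_of (P, c) - frag_of (Q, c)"
      "P \<in> carrier int_valued_ring"
  | (right) P c d where "f = frag_of (P, (c + d) mod m) - frag_of (P, c) - frag_of (P, d)"
    unfolding tensor_relations_def by (auto simp: int_valued_ring_def residue_ring_def)
  then show ?thesis
  proof cases
    case left
    then show ?thesis
      unfolding left(1) by (simp add: frag_value_diff floor_add distrib_right)
  next
    case right
    define v where "v = \<lfloor>poly P (of_nat n)\<rfloor>"
    have "[v * ((c + d) mod m) - v * c - v * d = v * (c + d) - v * c - v * d] (mod m)"
      by (intro cong_diff cong_mult cong_refl) (simp_all add: cong_def)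
    then show ?thesis unfolding right by (simp add: frag_value_diff v_def distrib_left)
  qed
qed

section \<open>The ring of integer-valued polynomials modulo \<open>p\<close>\<close>

lemma residue_ring_simps:
  "carrier (residue_ring m) = {0..m - 1}"
  "x \<otimes>\<^bsub>residue_ring m\<^esub> y = x * y mod m"
  "x \<oplus>\<^bsub>residue_ring m\<^esub> y = (x + y) mod m"
  "\<one>\<^bsub>residue_ring m\<^esub> = 1"
  "\<zero>\<^bsub>residue_ring m\<^esub> = 0"
  by (simp_all add: residue_ring_def)

lemma base_change_simps:
  "carrier (base_change A B) = carrier (tensor_ring A B)"
  "x \<otimes>\<^bsub>base_change A B\<^esub> y = x \<otimes>\<^bsub>tensor_ring A B\<^esub> y"
  "x \<oplus>\<^bsub>base_change A B\<^esub> y = x \<oplus>\<^bsub>tensor_ring A B\<^esub> y"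
  "\<one>\<^bsub>base_change A B\<^esub> = \<one>\<^bsub>tensor_ring A B\<^esub>"
  "\<zero>\<^bsub>base_change A B\<^esub> = \<zero>\<^bsub>tensor_ring A B\<^esub>"
  "c \<odot>\<^bsub>base_change A B\<^esub> x = pure_tensor A B \<one>\<^bsub>A\<^esub> c \<otimes>\<^bsub>tensor_ring A B\<^esub> x"
  by (simp_all add: base_change_def)

lemma int_valued_ring_simps:
  "P \<otimes>\<^bsub>int_valued_ring\<^esub> Q = P * Q"
  "P \<oplus>\<^bsub>int_valued_ring\<^esub> Q = P + Q"
  "\<one>\<^bsub>int_valued_ring\<^esub> = 1"
  "\<zero>\<^bsub>int_valued_ring\<^esub> = 0"
  by (simp_all add: int_valued_ring_def)

text \<open>The homomorphism \<open>ev\<^sub>n\<close>. An element of the tensor product is a coset of formal sums, on which the value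
modulo \<open>p\<close> is constant.\<close>

definition point_value :: "nat \<Rightarrow> nat \<Rightarrow> ((rat poly \<times> int) \<Rightarrow>\<^sub>0 int) set \<Rightarrow> int"
  where "point_value p n t = the_elem ((\<lambda>f. frag_value n f mod int p) ` t)"

text \<open>In characteristic zero, Newton's formula says that the \<open>k\<close>-th coefficient of a polynomial in the basis
\<open>binom x j\<close> is its \<open>k\<close>-th forward difference at \<open>0\<close>. The formula still makes sense modulo \<open>p\<close>.\<close>

definition diff_coord :: "nat \<Rightarrow> nat \<Rightarrow> ((rat poly \<times> int) \<Rightarrow>\<^sub>0 int) set \<Rightarrow> int"
  where "diff_coord p k t = (forward_diff ^^ k) (\<lambda>n. point_value p n t) 0 mod int p"

context
  fixes p :: nat
  assumes prime_p: "Factorial_Ring.prime p"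
begin

text \<open>The tensor product \<open>RFp\<close> is a quotient of the ring \<open>ZRFp\<close> of formal sums of pairs.\<close>

abbreviation (input) "Fp \<equiv> residue_ring (int p)"
abbreviation (input) "RFp \<equiv> int_valued_mod p"
abbreviation (input) "ZRFp \<equiv> integral_monoid_ring (int_valued_ring \<times>\<times> residue_ring (int p))"
abbreviation (input) "pt \<equiv> pure_tensor int_valued_ring (residue_ring (int p))"

lemma int_p_gt_1: "int p > 1"
  using prime_gt_1_nat [OF prime_p] by simp

lemma cring_residue_ring: "cring Fp"
  by (rule residues.cring) (rule residues.intro [OF int_p_gt_1])

interpretation K: cring Fp
  by (rule cring_residue_ring)

interpretation R: cring int_valued_ring
  by (rule cring_int_valued_ring)

interpretation F: cring ZRFp
proof (rule cring_integral_monoid_ring)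
  show "Group.comm_monoid (int_valued_ring \<times>\<times> Fp)"
    by (intro comm_monoidI) (auto simp: DirProd_def R.m_assoc K.m_assoc intro: R.m_comm K.m_comm)
qed

interpretation I: ideal "tensor_ideal int_valued_ring Fp" ZRFp
  by (rule ideal_tensor_ideal [OF cring_int_valued_ring cring_residue_ring])

interpretation T: cring "tensor_ring int_valued_ring Fp"
  by (rule cring_tensor_ring [OF cring_int_valued_ring cring_residue_ring])

interpretation q: ring_hom_ring ZRFp "tensor_ring int_valued_ring Fp"
    "(+>\<^bsub>ZRFp\<^esub>) (tensor_ideal int_valued_ring Fp)"
  unfolding tensor_ring_def by (rule I.rcos_ring_hom_ring)

lemmas pt_closed = pure_tensor_closed [OF cring_int_valued_ring cring_residue_ring]
  and pt_mult = pure_tensor_mult [OF cring_int_valued_ring cring_residue_ring]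
  and pt_add_left = pure_tensor_add_left [OF cring_int_valued_ring cring_residue_ring]

lemma module_int_valued_mod: "module Fp RFp"
  using algebra_base_change [OF cring_int_valued_ring cring_residue_ring] algebra.axioms(1) by blast

interpretation M: module Fp RFp
  by (rule module_int_valued_mod)

lemma frag_value_ring_hom: "(\<lambda>f. frag_value n f mod int p) \<in> ring_hom ZRFp Fp"
proof (rule ring_hom_memI)
  fix f assume "f \<in> carrier ZRFp"
  show "frag_value n f mod int p \<in> carrier Fp"
    using int_p_gt_1 by (simp add: residue_ring_simps)
next
  fix f g assume "f \<in> carrier ZRFp" "g \<in> carrier ZRFp"
  then show "frag_value n (f \<otimes>\<^bsub>ZRFp\<^esub> g) mod int p =
      (frag_value n f mod int p) \<otimes>\<^bsub>Fp\<^esub> (frag_value n g mod int p)"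
    using frag_value_mult_cong [of f "int p" g n]
    by (simp add: integral_monoid_ring_def residue_ring_simps cong_def mod_mult_eq)
  show "frag_value n (f \<oplus>\<^bsub>ZRFp\<^esub> g) mod int p =
      (frag_value n f mod int p) \<oplus>\<^bsub>Fp\<^esub> (frag_value n g mod int p)"
    by (simp add: integral_monoid_ring_def residue_ring_simps frag_value_add mod_add_eq)
next
  show "frag_value n \<one>\<^bsub>ZRFp\<^esub> mod int p = \<one>\<^bsub>Fp\<^esub>"
    using int_p_gt_1 by (simp add: integral_monoid_ring_def residue_ring_simps(4) int_valued_ring_simps)
qed

text \<open>The formal sums whose value is divisible by \<open>p\<close> form an ideal that contains the bilinearity
relations, hence the ideal they generate.\<close>

lemma frag_value_tensor_ideal:
  assumes "f \<in> tensor_ideal int_valued_ring Fp"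
  shows "frag_value n f mod int p = \<zero>\<^bsub>Fp\<^esub>"
proof -
  interpret h: ring_hom_ring ZRFp Fp "\<lambda>f. frag_value n f mod int p"
    by (intro ring_hom_ringI2 F.ring_axioms K.ring_axioms frag_value_ring_hom)
  let ?N = "a_kernel ZRFp Fp (\<lambda>f. frag_value n f mod int p)"
  have "tensor_ideal int_valued_ring Fp \<subseteq> ?N"
    unfolding tensor_ideal_def
  proof (rule F.genideal_minimal [OF h.kernel_is_ideal], rule subsetI)
    fix g assume g: "g \<in> tensor_relations int_valued_ring Fp"
    then have "g \<in> tensor_ideal int_valued_ring Fp"
      using tensor_relations_subset [OF cring_int_valued_ring cring_residue_ring] by blast
    then have "g \<in> carrier ZRFp"
      by (rule I.Icarr)
    moreover have "frag_value n g mod int p = 0"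
      using frag_value_tensor_relations [OF g, of n] by (simp add: cong_0_iff)
    ultimately show "g \<in> ?N" unfolding a_kernel_def' residue_ring_simps by blast
  qed
  then show ?thesis using assms unfolding a_kernel_def' by blast
qed

lemma point_value_ring_hom: "point_value p n \<in> ring_hom RFp Fp"
proof -
  have "point_value p n \<in> ring_hom (tensor_ring int_valued_ring Fp) Fp"
    unfolding point_value_def [abs_def] tensor_ring_def
    by (intro the_elem_quotient_ring_hom I.ideal_axioms K.ring_axioms frag_value_ring_hom
        frag_value_tensor_ideal)
  then show ?thesis by (simp add: ring_hom_def base_change_simps)
qed

lemma
  assumes "s \<in> carrier RFp" "t \<in> carrier RFp"
  shows point_value_add: "point_value p n (s \<oplus>\<^bsub>RFp\<^esub> t) =
      (point_value p n s + point_value p n t) mod int p"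
    and point_value_mult: "point_value p n (s \<otimes>\<^bsub>RFp\<^esub> t) =
      point_value p n s * point_value p n t mod int p"
  using ring_hom_add [OF point_value_ring_hom assms] ring_hom_mult [OF point_value_ring_hom assms]
  by (simp_all add: residue_ring_simps)

lemma point_value_one: "point_value p n \<one>\<^bsub>RFp\<^esub> = 1"
  using ring_hom_one [OF point_value_ring_hom] by (simp add: residue_ring_simps)

lemma point_value_pure_tensor:
  assumes "P \<in> carrier int_valued_ring" "c \<in> carrier Fp"
  shows "point_value p n (pt P c) = \<lfloor>poly P (of_nat n)\<rfloor> * c mod int p"
proof -
  have "frag_of (P, c) \<in> carrier ZRFp"
    using assms by (simp add: integral_monoid_ring_def DirProd_def)
  then show ?thesis
    unfolding point_value_def pure_tensor_def
    by (subst the_elem_image_coset [OF I.ideal_axioms K.ring_axioms frag_value_ring_hom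
          frag_value_tensor_ideal]) simp_all
qed

lemma point_value_smult:
  assumes "c \<in> carrier Fp" "t \<in> carrier RFp"
  shows "point_value p n (c \<odot>\<^bsub>RFp\<^esub> t) = c * point_value p n t mod int p"
proof -
  have "pt \<one>\<^bsub>int_valued_ring\<^esub> c \<in> carrier RFp"
    using assms(1) pt_closed by (simp add: base_change_simps(1))
  moreover have "point_value p n (pt \<one>\<^bsub>int_valued_ring\<^esub> c) = c"
    using assms(1) by (simp add: point_value_pure_tensor) (simp add: residue_ring_simps int_valued_ring_simps)
  ultimately show ?thesis
    using point_value_mult [OF _ assms(2)] by (simp add: base_change_simps)
qed

lemma binom_mod_closed: "binom_mod p k \<in> carrier RFp"
  unfolding binom_mod_def base_change_simps(1) by (intro pt_closed binom_poly_carrier K.one_closed)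

lemma point_value_binom_mod: "point_value p n (binom_mod p k) = int (n choose k) mod int p"
proof -
  have "poly (binom_poly k) (of_nat n) = of_nat (n choose k)"
    by (simp add: poly_binom_poly binomial_gbinomial)
  then show ?thesis
    unfolding binom_mod_def
    by (subst point_value_pure_tensor [OF binom_poly_carrier K.one_closed])
       (simp add: residue_ring_simps(4))
qed

subsection \<open>The binomial polynomials form a basis\<close>

lemma pure_tensor_zero_left:
  assumes "c \<in> carrier Fp"
  shows "pt \<zero>\<^bsub>int_valued_ring\<^esub> c = \<zero>\<^bsub>RFp\<^esub>"
proof -
  have "pt \<zero>\<^bsub>int_valued_ring\<^esub> c \<oplus>\<^bsub>RFp\<^esub> pt \<zero>\<^bsub>int_valued_ring\<^esub> c
      = pt \<zero>\<^bsub>int_valued_ring\<^esub> c"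
    using pt_add_left [OF R.zero_closed R.zero_closed assms] by (simp add: base_change_simps)
  moreover have "pt \<zero>\<^bsub>int_valued_ring\<^esub> c \<in> carrier RFp"
    using pt_closed [OF R.zero_closed assms] by (simp add: base_change_simps)
  ultimately show ?thesis using M.add.l_cancel_one by simp
qed

lemma of_int_mult_carrier:
  assumes "P \<in> carrier int_valued_ring"
  shows "of_int z * P \<in> carrier int_valued_ring"
proof -
  have "poly (of_int z) x = of_int z" for x :: rat by (cases z rule: int_diff_cases) simp
  then show ?thesis using assms by (auto simp: int_valued_ring_def)
qed

text \<open>Integers move across the tensor sign. The step \<open>z \<mapsto> z + 1\<close> adds the same element to both sides, and
by cancellation it can be reversed to reach the negative integers.\<close>

lemma pure_tensor_of_int_mult:
  assumes P: "P \<in> carrier int_valued_ring" and c: "c \<in> carrier Fp"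
  shows "pt (of_int z * P) c = (z * c mod int p) \<odot>\<^bsub>RFp\<^esub> pt P \<one>\<^bsub>Fp\<^esub>"
    (is "?L z = ?R z")
proof -
  let ?t = "pt P \<one>\<^bsub>Fp\<^esub>"
  have cl: "y mod int p \<in> carrier Fp" for y
    using int_p_gt_1 by (simp add: residue_ring_simps)
  have t: "?t \<in> carrier RFp"
    using pt_closed P by (simp add: base_change_simps(1))
  have Lc: "?L z \<in> carrier RFp" for z
    using pt_closed of_int_mult_carrier P c by (simp add: base_change_simps(1))
  have L1: "?L 1 = c \<odot>\<^bsub>RFp\<^esub> ?t"
    using P c by (simp add: base_change_simps pt_mult)
  have step: "?L (z + 1) = ?L z \<oplus>\<^bsub>RFp\<^esub> ?L 1"
      "?R (z + 1) = ?R z \<oplus>\<^bsub>RFp\<^esub> ?L 1" for z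
  proof -
    have "?L (z + 1) = pt ((of_int z * P) \<oplus>\<^bsub>int_valued_ring\<^esub> (of_int 1 * P)) c"
      by (simp add: int_valued_ring_simps distrib_right)
    also have "\<dots> = ?L z \<oplus>\<^bsub>RFp\<^esub> ?L 1"
      by (subst pt_add_left) (use of_int_mult_carrier P c in \<open>simp_all only: base_change_simps\<close>)
    finally show "?L (z + 1) = ?L z \<oplus>\<^bsub>RFp\<^esub> ?L 1" .
    have "(z + 1) * c mod int p = (z * c mod int p) \<oplus>\<^bsub>Fp\<^esub> c"
      by (simp add: residue_ring_simps distrib_right mod_add_left_eq)
    then show "?R (z + 1) = ?R z \<oplus>\<^bsub>RFp\<^esub> ?L 1"
      unfolding L1 using M.smult_l_distr [OF cl c t] by simp
  qed
  show ?thesis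
  proof (induction z rule: int_induct [where k = 0])
    case base
    then show ?case
      using pure_tensor_zero_left [OF c] M.smult_l_null [OF t]
      by (simp add: int_valued_ring_simps residue_ring_simps)
  next
    case (step1 i)
    then show ?case by (simp only: step)
  next
    case (step2 i)
    have "?L (i - 1) \<oplus>\<^bsub>RFp\<^esub> ?L 1 = ?R (i - 1) \<oplus>\<^bsub>RFp\<^esub> ?L 1"
      using step2 step [of "i - 1"] by simp
    then show ?case
      using M.add.right_cancel [OF Lc Lc, of "?R (i - 1)"] Lc cl t M.smult_closed by blast
  qed
qed

lemma pure_tensor_in_span:
  assumes "P \<in> carrier int_valued_ring" and c: "c \<in> carrier Fp"
  shows "pt P c \<in> lin_span Fp RFp (binom_mod p)"
proof -
  obtain N z where P: "P = (\<Sum>k<N. of_int (z k) * binom_poly k)"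
    using int_valued_eq_sum_binom_poly [OF assms(1)] by blast
  have "(\<Sum>k<n. of_int (z k) * binom_poly k) \<in> carrier int_valued_ring \<and>
      pt (\<Sum>k<n. of_int (z k) * binom_poly k) c \<in> lin_span Fp RFp (binom_mod p)" for n
  proof (induction n)
    case 0
    then show ?case
      using pure_tensor_zero_left [OF c] R.zero_closed lin_span.zero [of RFp]
      by (simp add: int_valued_ring_simps)
  next
    case (Suc n)
    let ?S = "\<Sum>k<n. of_int (z k) * binom_poly k"
    have S: "?S \<in> carrier int_valued_ring" and B: "of_int (z n) * binom_poly n \<in> carrier int_valued_ring"
      using Suc of_int_mult_carrier [OF binom_poly_carrier] by auto
    have "pt (?S + of_int (z n) * binom_poly n) c =
        pt ?S c \<oplus>\<^bsub>RFp\<^esub> (z n * c mod int p) \<odot>\<^bsub>RFp\<^esub> binom_mod p n"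
      using pt_add_left [OF S B c] pure_tensor_of_int_mult [OF binom_poly_carrier c]
      by (simp only: int_valued_ring_simps base_change_simps(3) binom_mod_def)
    moreover have "z n * c mod int p \<in> carrier Fp"
      using int_p_gt_1 by (simp add: residue_ring_simps)
    ultimately show ?case
      using R.a_closed [OF S B] lin_span.step [OF conjunct2 [OF Suc]] by (simp add: int_valued_ring_simps)
  qed
  then show ?thesis unfolding P by blast
qed

lemma range_binom_mod: "range (binom_mod p) \<subseteq> carrier RFp"
  using binom_mod_closed by auto

text \<open>Every element is the class of a formal sum, and formal sums are generated under subtraction by single pairs,
whose classes are the pure tensors.\<close>

lemma binom_mod_spans: "carrier RFp \<subseteq> lin_span Fp RFp (binom_mod p)"
proof
  let ?q = "\<lambda>f. tensor_ideal int_valued_ring Fp +>\<^bsub>ZRFp\<^esub> f"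
  let ?S = "lin_span Fp RFp (binom_mod p)"
  fix t assume "t \<in> carrier RFp"
  then obtain f where f: "f \<in> carrier ZRFp" "t = ?q f"
    unfolding base_change_simps tensor_ring_def FactRing_def A_RCOSETS_def' partial_object.simps by blast
  then have "Poly_Mapping.keys f \<subseteq> carrier (int_valued_ring \<times>\<times> Fp)"
    by (simp add: integral_monoid_ring_def)
  then have "f \<in> carrier ZRFp \<and> ?q f \<in> ?S"
  proof (induction f rule: frag_induction)
    case zero
    have "0 = \<zero>\<^bsub>ZRFp\<^esub>" by (simp add: integral_monoid_ring_def)
    then show ?case
      using q.hom_zero F.zero_closed lin_span.zero [of RFp] by (simp add: base_change_simps)
  next
    case (one x)
    then obtain P c where x: "x = (P, c)" "P \<in> carrier int_valued_ring" "c \<in> carrier Fp"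
      by (auto simp: DirProd_def)
    then show ?case
      using one pure_tensor_in_span [OF x(2,3)] by (simp add: pure_tensor_def integral_monoid_ring_def)
  next
    case (diff a b)
    then have a: "a \<in> carrier ZRFp" "?q a \<in> ?S" and b: "b \<in> carrier ZRFp" "?q b \<in> ?S" by auto
    have "\<ominus>\<^bsub>ZRFp\<^esub> b = - b"
      using b(1) by (intro F.minus_equality) (auto simp: integral_monoid_ring_def)
    then have ab: "a - b = a \<oplus>\<^bsub>ZRFp\<^esub> \<ominus>\<^bsub>ZRFp\<^esub> b" by (simp add: integral_monoid_ring_def)
    have "\<ominus>\<^bsub>RFp\<^esub> ?q b = ?q (\<ominus>\<^bsub>ZRFp\<^esub> b)"
    proof (rule M.minus_equality)
      show "?q (\<ominus>\<^bsub>ZRFp\<^esub> b) \<oplus>\<^bsub>RFp\<^esub> ?q b = \<zero>\<^bsub>RFp\<^esub>"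
        using q.hom_add [of "\<ominus>\<^bsub>ZRFp\<^esub> b" b] b(1) F.l_neg [OF b(1)] by (simp add: base_change_simps)
    qed (use b(1) in \<open>simp_all add: base_change_simps(1)\<close>)
    then have "?q (a - b) = ?q a \<oplus>\<^bsub>RFp\<^esub> \<ominus>\<^bsub>RFp\<^esub> ?q b"
      unfolding ab using q.hom_add [OF a(1), of "\<ominus>\<^bsub>ZRFp\<^esub> b"] b(1) by (simp add: base_change_simps(3))
    moreover have "a - b \<in> carrier ZRFp" unfolding ab using a(1) b(1) by simp
    ultimately show ?case
      using M.lin_span_add [OF range_binom_mod a(2) M.lin_span_minus [OF range_binom_mod b(2)]] by simp
  qed
  then show "t \<in> ?S" using f by simp
qed

lemma diff_coord_eqI:
  assumes "\<And>n. [point_value p n t = g n] (mod int p)"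
  shows "diff_coord p k t = (forward_diff ^^ k) g 0 mod int p"
  using forward_diff_funpow_cong [OF assms] by (simp add: diff_coord_def cong_def)

text \<open>Values are only known modulo \<open>p\<close>, but forward differences respect congruences, so the coordinates of a sum, a
multiple or a binomial may be computed from any integer-valued representative of its values.\<close>

lemma dual_basis_binom_mod: "dual_basis Fp RFp (binom_mod p) (diff_coord p)"
proof (unfold_locales, goal_cases)
  case 1
  show ?case by (rule range_binom_mod)
next
  case 2
  show ?case by (rule binom_mod_spans)
next
  case (3 t k)
  show ?case using int_p_gt_1 by (simp add: diff_coord_def residue_ring_simps)
next
  case (4 s t k)
  then show ?case
    using diff_coord_eqI [of "s \<oplus>\<^bsub>RFp\<^esub> t" "\<lambda>n. point_value p n s + point_value p n t" k]
    by (simp add: point_value_add residue_ring_simps forward_diff_funpow_add diff_coord_def mod_add_eq)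
next
  case (5 c t k)
  then show ?case
    using diff_coord_eqI [of "c \<odot>\<^bsub>RFp\<^esub> t" "\<lambda>n. c * point_value p n t" k]
    by (simp add: point_value_smult forward_diff_funpow_cmult diff_coord_def residue_ring_simps(2) mod_mult_right_eq)
next
  case (6 k j)
  show ?case
    using diff_coord_eqI [of "binom_mod p j" "\<lambda>n. int (n choose j)" k] int_p_gt_1
    by (simp add: point_value_binom_mod forward_diff_funpow_binomial_0 residue_ring_simps)
qed

interpretation M: dual_basis Fp RFp "binom_mod p" "diff_coord p"
  by (rule dual_basis_binom_mod)

lemma point_value_separates:
  assumes "s \<in> carrier RFp" "t \<in> carrier RFp"
    and "\<And>n. point_value p n s = point_value p n t"
  shows "s = t"
  by (rule M.coord_separates [OF assms(1,2)]) (simp add: diff_coord_def assms(3))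

lemma ex1_linear_extensions:
  assumes "\<And>k. g k \<in> carrier RFp"
  shows "\<exists>!f. f \<in> linear_extensions p g"
  unfolding linear_extensions_def mem_Collect_eq
  by (rule M.ex1_linear_extension [OF module_int_valued_mod]) (use assms in auto)

subsection \<open>The effect of \<open>\<Psi>\<close> on values\<close>

text \<open>\<open>ring_hom\<close> does not list preservation of zero; here \<open>0 = 0 \<cdot> 0\<close> gives it.\<close>

lemma point_value_zero: "point_value p n \<zero>\<^bsub>RFp\<^esub> = 0"
proof -
  have "\<zero>\<^bsub>Fp\<^esub> \<odot>\<^bsub>RFp\<^esub> \<zero>\<^bsub>RFp\<^esub> = \<zero>\<^bsub>RFp\<^esub>"
    by simp
  then have "point_value p n \<zero>\<^bsub>RFp\<^esub> =
      \<zero>\<^bsub>Fp\<^esub> * point_value p n \<zero>\<^bsub>RFp\<^esub> mod int p"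
    using point_value_smult [OF K.zero_closed M.M.zero_closed, of n] by simp
  then show ?thesis by (simp only: residue_ring_simps mult_zero_left mod_0)
qed

text \<open>On \<open>binom x k\<close> this is the congruence \<open>binom n (p k) \<equiv> binom (n div p) k\<close>, and both sides are linear in \<open>t\<close>.\<close>

lemma point_value_Psi:
  assumes Psi: "\<Psi> \<in> Psi_maps p" and t: "t \<in> carrier RFp"
  shows "point_value p n (\<Psi> t) = point_value p (n div p) t"
proof -
  from Psi have lin: "\<Psi> \<in> linear_maps Fp RFp RFp"
    and basis: "\<Psi> (binom_mod p k) = binom_mod p (p * k)" for k
    by (auto simp: linear_extensions_def)
  from t binom_mod_spans have "t \<in> lin_span Fp RFp (binom_mod p)" by blast
  then show ?thesis
  proof induction
    case zero
    then show ?case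
      using linear_maps_zero [OF M.abelian_group_axioms M.abelian_group_axioms lin]
      by (simp add: point_value_zero)
  next
    case (step t c k)
    have t: "t \<in> carrier RFp"
      by (rule M.lin_span_closed [OF range_binom_mod step(1)])
    have "point_value p n (binom_mod p (p * k)) = point_value p (n div p) (binom_mod p k)"
      using binomial_prime_mult_cong [OF prime_p, of n k]
      by (simp add: point_value_binom_mod cong_def flip: of_nat_mod)
    then show ?case
      using t step(2,3) binom_mod_closed
      by (simp add: linear_maps_add [OF lin] linear_maps_smult [OF lin] linear_maps_closed [OF lin]
          basis point_value_add point_value_smult)
  qed
qed

text \<open>Since \<open>n div p\<close> does not depend on the element, the values of \<open>\<Psi> x \<Psi> y\<close> and of \<open>\<Psi> (x y)\<close> at \<open>n\<close> are both the
product of the values of \<open>x\<close> and \<open>y\<close> at \<open>n div p\<close>.\<close>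

lemma Psi_ring_hom:
  assumes "\<Psi> \<in> Psi_maps p"
  shows "\<Psi> \<in> ring_hom RFp RFp"
proof (rule ring_hom_memI)
  from assms have lin: "\<Psi> \<in> linear_maps Fp RFp RFp"
    by (auto simp: linear_extensions_def)
  have mult: "x \<otimes>\<^bsub>RFp\<^esub> y \<in> carrier RFp"
    if "x \<in> carrier RFp" "y \<in> carrier RFp" for x y
    using that by (simp add: base_change_simps)
  have one: "\<one>\<^bsub>RFp\<^esub> \<in> carrier RFp"
    by (simp add: base_change_simps)
  show closed: "\<Psi> x \<in> carrier RFp" if "x \<in> carrier RFp" for x
    using linear_maps_closed [OF lin that] .
  show "\<Psi> (x \<oplus>\<^bsub>RFp\<^esub> y) = \<Psi> x \<oplus>\<^bsub>RFp\<^esub> \<Psi> y"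
    if "x \<in> carrier RFp" "y \<in> carrier RFp" for x y
    using linear_maps_add [OF lin that] .
  show "\<Psi> (x \<otimes>\<^bsub>RFp\<^esub> y) = \<Psi> x \<otimes>\<^bsub>RFp\<^esub> \<Psi> y"
    if "x \<in> carrier RFp" "y \<in> carrier RFp" for x y
    by (rule point_value_separates)
       (use that in \<open>simp_all add: mult closed point_value_Psi [OF assms] point_value_mult\<close>)
  show "\<Psi> \<one>\<^bsub>RFp\<^esub> = \<one>\<^bsub>RFp\<^esub>"
    by (rule point_value_separates)
       (simp_all add: one closed point_value_Psi [OF assms] point_value_one)
qed

lemma Psi_tilde_Psi:
  assumes Psi: "\<Psi> \<in> Psi_maps p" and Psi': "\<Psi>' \<in> Psi_tilde_maps p"
    and t: "t \<in> carrier RFp"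
  shows "\<Psi>' (\<Psi> t) = t"
proof -
  let ?L = "linear_maps Fp RFp RFp"
  have lin: "\<Psi> \<in> ?L" and lin': "\<Psi>' \<in> ?L"
    using Psi Psi' by (auto simp: linear_extensions_def)
  have "p > 0" using prime_gt_0_nat [OF prime_p] .
  then have basis: "\<Psi>' (\<Psi> (binom_mod p k)) = binom_mod p k" for k
    using Psi Psi' by (simp add: linear_extensions_def)
  have span: "t \<in> lin_span Fp RFp (binom_mod p)"
    using t binom_mod_spans by blast
  have "(\<lambda>s\<in>carrier RFp. \<Psi>' (\<Psi> s)) t = (\<lambda>s\<in>carrier RFp. s) t"
    by (rule linear_maps_eq_on_span [OF module_int_valued_mod module_int_valued_mod
          linear_maps_compose [OF module_int_valued_mod lin lin']
          linear_maps_ident [OF module_int_valued_mod] range_binom_mod _ span])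
       (simp add: binom_mod_closed basis)
  then show ?thesis using t by simp
qed

end

theorem corollary7p2:
  fixes p :: nat
  assumes "Factorial_Ring.prime p"
  shows "(\<exists>!\<Psi>. \<Psi> \<in> Psi_maps p) \<and>
         (\<exists>!\<Psi>'. \<Psi>' \<in> Psi_tilde_maps p) \<and>
         (\<forall>\<Psi> \<in> Psi_maps p. \<Psi> \<in> ring_hom (int_valued_mod p) (int_valued_mod p)) \<and>
         (\<forall>\<Psi> \<in> Psi_maps p. \<forall>\<Psi>' \<in> Psi_tilde_maps p.
            \<forall>t \<in> carrier (int_valued_mod p). \<Psi>' (\<Psi> t) = t)"
proof (intro conjI ballI)
  show "\<exists>!\<Psi>. \<Psi> \<in> Psi_maps p"
    by (intro ex1_linear_extensions binom_mod_closed assms)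
  have "abelian_group (int_valued_mod p)"
    using module_int_valued_mod [OF assms] by (rule module.axioms)
  then have "\<zero>\<^bsub>int_valued_mod p\<^esub> \<in> carrier (int_valued_mod p)"
    using abelian_monoid.zero_closed abelian_group.axioms(1) by blast
  then show "\<exists>!\<Psi>'. \<Psi>' \<in> Psi_tilde_maps p"
    by (intro ex1_linear_extensions assms) (simp add: binom_mod_closed [OF assms])
qed (use Psi_ring_hom [OF assms] Psi_tilde_Psi [OF assms] in blast)+

end
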